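(* Let $A\sim P_{\theta^*,z^*}$ be generated from a stochastic block model with $n$ nodes and $k$ communities in the dense regime ($\rho_n\equiv 1$), and suppose that: (A1) there exists $C_1>0$ such that $\min_{1\le a\le k} n_a\ge C_1 n/k$ for all $n$; (A2) any two rows of $\theta^*$ are distinct; (A3) the entries of $\theta^*$ are uniformly bounded away from $0$ and $1$; (A4) $n\mu/\log k\to-\infty$ for $k'<k$. Let $$\ell(k)=\max_{z\in[k]^n}\sup_{\theta\in\Theta_k}\log f(A|\theta,z)-\Big[\lambda n\log k+\frac{k(k+1)}{2}\log n\Big]$$ be the penalized likelihood function of the corrected Bayesian information criterion, with tuning parameter $\lambda\ge 0$. Suppose $k=o((n/\log n)^{1/2})$. Then, as $n\to\infty$: (i) for $k'<k$, $P(\ell(k')>\ell(k))\to 0$; (ii) for $k'>k$, when $\lambda>(\alpha\log k')/(\log k'-\log k)$, $P(\ell(k')>\ell(k))\to 0$, where $\alpha$ is the coefficient in the overfitting bound described in the context.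
   Context: Setting: $n\to\infty$; the number of communities $k$, the true labels $z^*$ and the true matrix $\theta^*$ may depend on $n$. For a label vector $z\in[k]^n$ (i.e. $z:[n]\to[k]$) and a symmetric matrix $\theta=(\theta_{ab})_{1\le a,b\le k}$ with entries in $[0,1]$ (identified with an element of $\Theta_k=[0,1]^{k(k+1)/2}$), $A\sim P_{\theta,z}$ means that $A\in\{0,1\}^{n\times n}$ is symmetric with zero diagonal and $(A_{ij})_{i<j}$ are independent Bernoulli variables with $P(A_{ij}=1)=\theta_{z(i)z(j)}$. The log-likelihood is $\log f(A|\theta,z)=\sum_{1\le a\le b\le k}\big(m_{ab}\log\theta_{ab}+(n_{ab}-m_{ab})\log(1-\theta_{ab})\big)$, where $n_a=\sum_i\mathbf 1\{z(i)=a\}$; for $a\ne b$, $n_{ab}=n_an_b$ and $m_{ab}=\sum_{i}\sum_{j\ne i}A_{ij}\mathbf 1\{z(i)=a,z(j)=b\}$; $n_{aa}=n_a(n_a-1)/2$ and $m_{aa}=\sum_{i<j}A_{ij}\mathbf 1\{z(i)=z(j)=a\}$ (with $0\log 0=0$). The true parameter is $(\theta^*,z^* )$ with $k$ communities; in (A1), $n_a$ is computed at $z^*$. The regime $\rho_n\equiv1$ means that the overall density of the network does not vanish (no sparsity scaling of $\theta^*$). Log-likelihood ratio: $L_{k,k'}=\max_{z\in[k']^n}\sup_{\theta\in\Theta_{k'}}\log f(A|\theta,z)-\log f(A|\theta^*,z^* )$. The quantity $\mu$ in (A4): for $k'<k$, $\mu$ is the expectation of $n^{-2}L_{k,k'}$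 (it depends on $n,k,k',\theta^*,z^*$). The quantity $\alpha$ in (ii): for $k'>k$, $\alpha$ is a number satisfying $0<\alpha\le 1-\frac{C}{\log k'}+\frac{2\log n+\log k}{n\log k'}$, with $C>0$ a constant, for which the bound $L_{k,k'}\le\alpha n\log k'+\sup_{\theta\in\Theta_k}\log f(A|\theta,z^* )-\log f(A|\theta^*,z^* )$ holds with probability tending to 1. *)

theory Defs
  imports "HOL-Probability.Probability" "HOL-Library.Landau_Symbols"
begin

definition labels :: "nat \<Rightarrow> nat \<Rightarrow> (nat \<Rightarrow> nat) set" where
  "labels n k = {1..n} \<rightarrow>\<^sub>E {1..k}"

(* Only the entries with indices in {1..k} matter; entries outside are unconstrained. *)
definition Theta :: "nat \<Rightarrow> (nat \<Rightarrow> nat \<Rightarrow> real) set" where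
  "Theta k = {\<theta>. \<forall>a\<in>{1..k}. \<forall>b\<in>{1..k}. \<theta> a b = \<theta> b a \<and> 0 \<le> \<theta> a b \<and> \<theta> a b \<le> 1}"

(* The coordinates of Pi_pmf outside the index set are constantly False, so the diagonal
   of the symmetrised matrix is zero. *)
definition sbm :: "nat \<Rightarrow> (nat \<Rightarrow> nat \<Rightarrow> real) \<Rightarrow> (nat \<Rightarrow> nat) \<Rightarrow> (nat \<Rightarrow> nat \<Rightarrow> bool) pmf" where
  "sbm n \<theta> z =
     map_pmf (\<lambda>B i j. B (min i j, max i j))
       (Pi_pmf {(i, j). 1 \<le> i \<and> i < j \<and> j \<le> n} False
          (\<lambda>(i, j). bernoulli_pmf (\<theta> (z i) (z j))))"

definition comm_size :: "nat \<Rightarrow> (nat \<Rightarrow> nat) \<Rightarrow> nat \<Rightarrow> nat" where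
  "comm_size n z a = (\<Sum>i\<in>{1..n}. of_bool (z i = a))"

definition n_pairs :: "nat \<Rightarrow> (nat \<Rightarrow> nat) \<Rightarrow> nat \<Rightarrow> nat \<Rightarrow> nat" where
  "n_pairs n z a b =
     (if a = b then comm_size n z a * (comm_size n z a - 1) div 2
      else comm_size n z a * comm_size n z b)"

definition m_edges ::
    "nat \<Rightarrow> (nat \<Rightarrow> nat \<Rightarrow> bool) \<Rightarrow> (nat \<Rightarrow> nat) \<Rightarrow> nat \<Rightarrow> nat \<Rightarrow> nat" where
  "m_edges n A z a b =
     (if a = b then \<Sum>i\<in>{1..n}. \<Sum>j\<in>{i<..n}. of_bool (A i j \<and> z i = a \<and> z j = a)
      else \<Sum>i\<in>{1..n}. \<Sum>j\<in>{1..n} - {i}. of_bool (A i j \<and> z i = a \<and> z j = b))"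

(* The real-valued library function has ln 0 = 0; the likelihood needs log 0 = -\<infinity>.
   With this, 0 log 0 = 0 holds by the ereal convention 0 * -\<infinity> = 0. *)
definition elog :: "real \<Rightarrow> ereal" where
  "elog t = (if t = 0 then -\<infinity> else ereal (ln t))"

definition loglik ::
    "nat \<Rightarrow> nat \<Rightarrow> (nat \<Rightarrow> nat \<Rightarrow> bool) \<Rightarrow> (nat \<Rightarrow> nat \<Rightarrow> real) \<Rightarrow> (nat \<Rightarrow> nat) \<Rightarrow> ereal" where
  "loglik n k A \<theta> z =
     (\<Sum>a\<in>{1..k}. \<Sum>b\<in>{a..k}.
        ereal (real (m_edges n A z a b)) * elog (\<theta> a b) +
        ereal (real (n_pairs n z a b) - real (m_edges n A z a b)) * elog (1 - \<theta> a b))"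

definition sup_loglik ::
    "nat \<Rightarrow> nat \<Rightarrow> (nat \<Rightarrow> nat \<Rightarrow> bool) \<Rightarrow> (nat \<Rightarrow> nat) \<Rightarrow> ereal" where
  "sup_loglik n k A z = (SUP \<theta>\<in>Theta k. loglik n k A \<theta> z)"

definition max_loglik :: "nat \<Rightarrow> nat \<Rightarrow> (nat \<Rightarrow> nat \<Rightarrow> bool) \<Rightarrow> ereal" where
  "max_loglik n k A = Max (sup_loglik n k A ` labels n k)"

definition LR ::
    "nat \<Rightarrow> nat \<Rightarrow> nat \<Rightarrow> (nat \<Rightarrow> nat \<Rightarrow> real) \<Rightarrow> (nat \<Rightarrow> nat) \<Rightarrow> (nat \<Rightarrow> nat \<Rightarrow> bool) \<Rightarrow> ereal" where
  "LR n k k' \<theta> z A = max_loglik n k' A - loglik n k A \<theta> z"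

(* The ratio is finite almost surely when the entries of \<theta> lie strictly between 0 and 1,
   so passing to the reals loses nothing there. *)
definition mu ::
    "nat \<Rightarrow> nat \<Rightarrow> nat \<Rightarrow> (nat \<Rightarrow> nat \<Rightarrow> real) \<Rightarrow> (nat \<Rightarrow> nat) \<Rightarrow> real" where
  "mu n k k' \<theta> z =
     measure_pmf.expectation (sbm n \<theta> z) (\<lambda>A. real_of_ereal (LR n k k' \<theta> z A) / (real n)\<^sup>2)"

definition cbic :: "nat \<Rightarrow> real \<Rightarrow> nat \<Rightarrow> (nat \<Rightarrow> nat \<Rightarrow> bool) \<Rightarrow> ereal" where
  "cbic n lam k A =
     max_loglik n k A -
     ereal (lam * real n * ln (real k) + real k * (real k + 1) / 2 * ln (real n))"

(* The defining property of the overfitting coefficient, as a sequence in n; it is allowed to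
   depend on n because its upper bound does. *)
definition overfit_coeff ::
    "(nat \<Rightarrow> nat) \<Rightarrow> (nat \<Rightarrow> nat \<Rightarrow> nat \<Rightarrow> real) \<Rightarrow> (nat \<Rightarrow> nat \<Rightarrow> nat) \<Rightarrow>
     (nat \<Rightarrow> nat) \<Rightarrow> (nat \<Rightarrow> real) \<Rightarrow> bool" where
  "overfit_coeff k \<theta> z k' \<alpha> \<longleftrightarrow>
     (\<exists>C>0. \<forall>\<^sub>F n in sequentially.
        0 < \<alpha> n \<and>
        \<alpha> n \<le> 1 - C / ln (real (k' n))
               + (2 * ln (real n) + ln (real (k n))) / (real n * ln (real (k' n)))) \<and>
     (\<lambda>n. measure_pmf.prob (sbm n (\<theta> n) (z n))
        {A. LR n (k n) (k' n) (\<theta> n) (z n) A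
              \<le> ereal (\<alpha> n * real n * ln (real (k' n)))
                + (sup_loglik n (k n) A (z n) - loglik n (k n) A (\<theta> n) (z n))}) \<longlonglongrightarrow> 1"

end

theory Submission
  imports Defs
begin

text \<open>Overfitting is immediate from the defining bound of \<open>\<alpha>\<close>. For underfitting no concentration
  inequality for the maximum is needed. For fixed \<open>(\<eta>, w)\<close> the likelihood ratio \<open>R\<close> against the truth
  satisfies \<open>E (sqrt R) \<le> exp (- D / 4)\<close>, where \<open>D\<close> is the sum over the edges of the squared differences
  of the edge probabilities, so by Markov's inequality \<open>P (R > exp (- t)) \<le> exp (t / 2 - D / 4)\<close>. The maximum
  likelihood estimate consists of fractions \<open>m / N\<close> with \<open>m, N \<le> n\<^sup>2\<close>, so a union bound over labels
  and such matrices costs only \<open>exp (n log k' + O(k\<^sup>2 log n)) = exp (O(n log k))\<close>. Finally, the expected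
  log-likelihood ratio of any fixed \<open>(\<eta>, w)\<close> is a lower bound for \<open>n\<^sup>2 \<mu>\<close>, which gives
  \<open>n\<^sup>2 \<mu> \<ge> - D / c\<^sup>2\<close>; with (A4), \<open>D\<close> therefore exceeds every multiple of \<open>n log k\<close>.\<close>

section \<open>Edges sorted into blocks, and the likelihood as a product\<close>

definition pairs :: "nat \<Rightarrow> (nat \<times> nat) set" where
  "pairs n = {(i, j). 1 \<le> i \<and> i < j \<and> j \<le> n}"

text \<open>Sorting the two labels puts every edge into exactly one block with
  \<open>a \<le> b\<close>, the index range over which \<open>loglik\<close> sums.\<close>

definition block :: "nat \<Rightarrow> (nat \<Rightarrow> nat) \<Rightarrow> nat \<Rightarrow> nat \<Rightarrow> (nat \<times> nat) set" where
  "block n z a b = {e \<in> pairs n. (min (z (fst e)) (z (snd e)), max (z (fst e)) (z (snd e))) = (a, b)}"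

text \<open>A real-valued product over edges: probabilities 0 and 1 cause no infinities, and
  independence of the edges applies factor by factor.\<close>

definition lik ::
    "nat \<Rightarrow> (nat \<Rightarrow> nat \<Rightarrow> bool) \<Rightarrow> (nat \<Rightarrow> nat \<Rightarrow> real) \<Rightarrow> (nat \<Rightarrow> nat) \<Rightarrow> real" where
  "lik n A \<theta> z = (\<Prod>(i, j)\<in>pairs n. if A i j then \<theta> (z i) (z j) else 1 - \<theta> (z i) (z j))"

lemma finite_pairs [simp]: "finite (pairs n)"
  by (rule finite_subset[of _ "{1..n} \<times> {1..n}"]) (auto simp: pairs_def)

lemma finite_block [simp]: "finite (block n z a b)"
  by (simp add: block_def)

text \<open>Off the diagonal, \<open>m_edges\<close> runs over ordered pairs whose first node has
  label \<open>a\<close> and second label \<open>b\<close>. Sorting the two nodes loses nothing,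
  since the distinct labels still tell which came first, and symmetry of \<open>A\<close> keeps the
  edge indicator unchanged.\<close>

lemma m_edges_eq_card:
  assumes sym: "\<And>i j. A i j = A j i" and "a \<le> b"
  shows "m_edges n A z a b = card {(i, j) \<in> block n z a b. A i j}"
proof (cases "a = b")
  case True
  have "m_edges n A z a b = card (SIGMA i:{1..n}. {j\<in>{i<..n}. A i j \<and> z i = a \<and> z j = a})"
    using True by (simp add: m_edges_def Int_def)
  also have "(SIGMA i:{1..n}. {j\<in>{i<..n}. A i j \<and> z i = a \<and> z j = a}) = {(i, j) \<in> block n z a b. A i j}"
    using True by (auto simp: block_def pairs_def min_def max_def split: if_splits)
  finally show ?thesis .
next
  case False
  let ?S = "SIGMA i:{1..n}. {j\<in>{1..n}-{i}. A i j \<and> z i = a \<and> z j = b}"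
  let ?T = "{(i, j) \<in> block n z a b. A i j}"
  let ?f = "\<lambda>(i::nat, j::nat). (min i j, max i j)"
  have "bij_betw ?f ?S ?T"
    unfolding bij_betw_def
  proof
    show "inj_on ?f ?S"
      using False by (auto simp: inj_on_def min_def max_def split: if_splits)
    show "?f ` ?S = ?T"
    proof
      show "?f ` ?S \<subseteq> ?T"
        using False \<open>a \<le> b\<close> sym by (auto simp: block_def pairs_def min_def max_def split: if_splits)
      show "?T \<subseteq> ?f ` ?S"
      proof
        fix e assume "e \<in> ?T"
        then obtain i j where e: "e = (i, j)" "1 \<le> i" "i < j" "j \<le> n" "A i j"
          "min (z i) (z j) = a" "max (z i) (z j) = b"
          by (auto simp: block_def pairs_def)
        show "e \<in> ?f ` ?S"
        proof (cases "z i \<le> z j")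
          case True
          then show ?thesis using e by (intro image_eqI[of _ _ "(i, j)"]) auto
        next
          case False
          then show ?thesis using e sym by (intro image_eqI[of _ _ "(j, i)"]) auto
        qed
      qed
    qed
  qed
  then have "card ?S = card ?T" by (rule bij_betw_same_card)
  then show ?thesis using False by (simp add: m_edges_def Int_def)
qed

text \<open>The square of \<open>S\<close> splits into the pairs with \<open>i < j\<close>, their
  mirror images and the diagonal.\<close>

lemma card_less_pairs:
  fixes S :: "nat set"
  assumes "finite S"
  shows "card {(i, j). i \<in> S \<and> j \<in> S \<and> i < j} = card S * (card S - 1) div 2"
proof -
  let ?L = "{(i, j). i \<in> S \<and> j \<in> S \<and> i < j}"
  have fin: "finite ?L" by (rule finite_subset[of _ "S \<times> S"]) (use assms in auto)
  have un: "S \<times> S = (?L \<union> prod.swap ` ?L) \<union> (\<lambda>i. (i, i)) ` S"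
    by (auto simp: image_iff)
  have sw: "card (prod.swap ` ?L) = card ?L" by (rule card_image) (auto simp: inj_on_def)
  have dg: "card ((\<lambda>i. (i, i)) ` S) = card S" by (rule card_image) (auto simp: inj_on_def)
  have "card S * card S = card (S \<times> S)" by (simp add: card_cartesian_product)
  also have "\<dots> = card (?L \<union> prod.swap ` ?L) + card ((\<lambda>i. (i, i)) ` S)"
    by (subst un, rule card_Un_disjoint) (use fin assms in auto)
  also have "card (?L \<union> prod.swap ` ?L) = card ?L + card ?L"
    by (subst card_Un_disjoint) (use fin sw in auto)
  finally have "card S * (card S - 1) = 2 * card ?L"
    by (simp add: dg diff_mult_distrib2)
  then show ?thesis by simp
qed

lemma n_pairs_eq_card:
  assumes "a \<le> b"
  shows "n_pairs n z a b = card (block n z a b)"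
proof (cases "a = b")
  case True
  let ?S = "{i\<in>{1..n}. z i = a}"
  have cs: "comm_size n z a = card ?S" by (simp add: comm_size_def Int_def)
  have "block n z a b = {(i, j). i \<in> ?S \<and> j \<in> ?S \<and> i < j}"
    using True by (auto simp: block_def pairs_def min_def max_def split: if_splits)
  then have "card (block n z a b) = card ?S * (card ?S - 1) div 2"
    by (simp only:) (rule card_less_pairs, simp)
  then show ?thesis using True cs by (simp add: n_pairs_def)
next
  case False
  \<comment> \<open>The size of a block is its edge count in the complete graph, so the bijection of
    \<open>m_edges_eq_card\<close> need not be repeated.\<close>
  have "card (block n z a b) = m_edges n (\<lambda>_ _. True) z a b"
    using assms by (subst m_edges_eq_card) auto
  also have "\<dots> = card ({i\<in>{1..n}. z i = a} \<times> {i\<in>{1..n}. z i = b})"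
  proof -
    have "m_edges n (\<lambda>_ _. True) z a b = card (SIGMA i:{1..n}. {j\<in>{1..n}-{i}. z i = a \<and> z j = b})"
      using False by (simp add: m_edges_def Int_def)
    also have "(SIGMA i:{1..n}. {j\<in>{1..n}-{i}. z i = a \<and> z j = b})
        = {i\<in>{1..n}. z i = a} \<times> {i\<in>{1..n}. z i = b}"
      using False by auto
    finally show ?thesis .
  qed
  finally show ?thesis using False by (simp add: n_pairs_def comm_size_def Int_def)
qed

lemma m_edges_le_n_pairs:
  assumes "\<And>i j. A i j = A j i" and "a \<le> b"
  shows "m_edges n A z a b \<le> n_pairs n z a b"
  using assms by (auto simp: m_edges_eq_card n_pairs_eq_card intro!: card_mono)

lemma n_pairs_le: "a \<le> b \<Longrightarrow> n_pairs n z a b \<le> n\<^sup>2"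
proof -
  assume "a \<le> b"
  have "card (block n z a b) \<le> card ({1..n} \<times> {1..n})"
    by (rule card_mono) (auto simp: block_def pairs_def)
  then show ?thesis using \<open>a \<le> b\<close> by (simp add: n_pairs_eq_card power2_eq_square)
qed

text \<open>Group the edges by their sorted pair of labels. By symmetry of \<open>\<theta>\<close>
  the edge probability is constant on each block, so only the number of present and absent edges
  matters.\<close>

lemma lik_eq_prod_blocks:
  assumes sym: "\<And>i j. A i j = A j i" and th: "\<theta> \<in> Theta K" and z: "z \<in> labels n K"
  shows "lik n A \<theta> z = (\<Prod>a\<in>{1..K}. \<Prod>b\<in>{a..K}.
     \<theta> a b ^ m_edges n A z a b * (1 - \<theta> a b) ^ (n_pairs n z a b - m_edges n A z a b))"
proof -
  let ?h = "\<lambda>e. if A (fst e) (snd e) then \<theta> (z (fst e)) (z (snd e)) else 1 - \<theta> (z (fst e)) (z (snd e))"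
  let ?g = "\<lambda>e. (min (z (fst e)) (z (snd e)), max (z (fst e)) (z (snd e)))"
  let ?T = "SIGMA a:{1..K}. {a..K}"
  have zr: "z i \<in> {1..K}" if "i \<in> {1..n}" for i using z that by (auto simp: labels_def)
  have "lik n A \<theta> z = prod ?h (pairs n)" by (simp add: lik_def case_prod_beta)
  also have "\<dots> = (\<Prod>y\<in>?T. prod ?h {e\<in>pairs n. ?g e = y})"
  proof (rule prod.group[symmetric])
    show "?g ` pairs n \<subseteq> ?T"
    proof (rule image_subsetI)
      fix e assume "e \<in> pairs n"
      then show "?g e \<in> ?T"
        using zr[of "fst e"] zr[of "snd e"] by (auto simp: pairs_def min_def max_def)
    qed
  qed auto
  also have "\<dots> = (\<Prod>a\<in>{1..K}. \<Prod>b\<in>{a..K}. prod ?h (block n z a b))"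
    by (subst prod.Sigma) (auto simp: block_def intro!: prod.cong)
  also have "\<dots> = (\<Prod>a\<in>{1..K}. \<Prod>b\<in>{a..K}.
     \<theta> a b ^ m_edges n A z a b * (1 - \<theta> a b) ^ (n_pairs n z a b - m_edges n A z a b))"
  proof (intro prod.cong refl)
    fix a b assume ab: "a \<in> {1..K}" "b \<in> {a..K}"
    have sy: "\<theta> x y = \<theta> (min x y) (max x y)" if "x \<in> {1..K}" "y \<in> {1..K}" for x y
      using th that by (auto simp: Theta_def min_def max_def)
    let ?E = "{(i, j) \<in> block n z a b. A i j}"
    have sub: "?E \<subseteq> block n z a b" by auto
    have "prod ?h (block n z a b) = (\<Prod>e\<in>block n z a b. if e \<in> ?E then \<theta> a b else 1 - \<theta> a b)"
    proof (intro prod.cong refl)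
      fix e assume e: "e \<in> block n z a b"
      then have "\<theta> (z (fst e)) (z (snd e)) = \<theta> a b"
        using sy[of "z (fst e)" "z (snd e)"] zr[of "fst e"] zr[of "snd e"]
        by (auto simp: block_def pairs_def)
      then show "?h e = (if e \<in> ?E then \<theta> a b else 1 - \<theta> a b)" using e by auto
    qed
    also have "\<dots> = \<theta> a b ^ card ?E * (1 - \<theta> a b) ^ card (block n z a b - ?E)"
      using sub by (simp add: prod.If_cases Int_absorb1 Diff_eq)
    also have "card (block n z a b - ?E) = card (block n z a b) - card ?E"
      by (rule card_Diff_subset[OF finite_subset[OF sub] sub]) simp
    finally show "prod ?h (block n z a b) =
        \<theta> a b ^ m_edges n A z a b * (1 - \<theta> a b) ^ (n_pairs n z a b - m_edges n A z a b)"
      using ab by (simp add: m_edges_eq_card[of A, OF sym] n_pairs_eq_card)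
  qed
  finally show ?thesis .
qed

text \<open>Safe in the extended reals because \<open>elog\<close> never equals plus infinity: a
  vanishing factor sends both sides to minus infinity.\<close>

lemma elog_mult:
  assumes "0 \<le> x" "0 \<le> y"
  shows "elog (x * y) = elog x + elog y"
  using assms by (auto simp: elog_def ln_mult)

lemma elog_prod:
  assumes "finite S" "\<And>i. i \<in> S \<Longrightarrow> 0 \<le> f i"
  shows "elog (\<Prod>i\<in>S. f i) = (\<Sum>i\<in>S. elog (f i))"
  using assms by (induction rule: finite_induct) (auto simp: elog_mult prod_nonneg, simp add: elog_def)

lemma elog_power:
  assumes "0 \<le> x"
  shows "elog (x ^ m) = ereal (real m) * elog x"
  using assms by (cases "m = 0") (auto simp: elog_def ln_realpow zero_ereal_def)

lemma elog_le_iff: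
  assumes "0 \<le> x" "0 \<le> y"
  shows "elog x \<le> elog y \<longleftrightarrow> x \<le> y"
  using assms by (auto simp: elog_def)

text \<open>The bridge from the extended-real log-likelihood to real products. Symmetry of
  \<open>A\<close> is available on the support of \<open>sbm\<close>, which is why later comparisons
  hold almost everywhere.\<close>

lemma loglik_eq_elog_lik:
  assumes sym: "\<And>i j. A i j = A j i" and th: "\<theta> \<in> Theta K" and z: "z \<in> labels n K"
  shows "loglik n K A \<theta> z = elog (lik n A \<theta> z)"
proof -
  let ?m = "m_edges n A z" and ?N = "n_pairs n z"
  have t: "0 \<le> \<theta> a b" "0 \<le> 1 - \<theta> a b" if "a \<in> {1..K}" "b \<in> {a..K}" for a b
    using th that by (auto simp: Theta_def)
  have "elog (lik n A \<theta> z) = (\<Sum>a\<in>{1..K}. \<Sum>b\<in>{a..K}.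
      elog (\<theta> a b ^ ?m a b * (1 - \<theta> a b) ^ (?N a b - ?m a b)))"
    unfolding lik_eq_prod_blocks[of A, OF sym th z]
  proof (subst elog_prod)
    show "0 \<le> (\<Prod>b\<in>{a..K}. \<theta> a b ^ ?m a b * (1 - \<theta> a b) ^ (?N a b - ?m a b))"
      if "a \<in> {1..K}" for a
      using t that by (intro prod_nonneg ballI mult_nonneg_nonneg zero_le_power) auto
    show "(\<Sum>a\<in>{1..K}. elog (\<Prod>b\<in>{a..K}. \<theta> a b ^ ?m a b * (1 - \<theta> a b) ^ (?N a b - ?m a b))) =
        (\<Sum>a\<in>{1..K}. \<Sum>b\<in>{a..K}. elog (\<theta> a b ^ ?m a b * (1 - \<theta> a b) ^ (?N a b - ?m a b)))"
      using t by (intro sum.cong refl elog_prod mult_nonneg_nonneg zero_le_power) auto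
  qed simp
  also have "\<dots> = loglik n K A \<theta> z"
    unfolding loglik_def
  proof (intro sum.cong refl)
    fix a b assume ab: "a \<in> {1..K}" "b \<in> {a..K}"
    \<comment> \<open>The exponent in \<open>lik\<close> is a truncated difference of naturals; this
      inequality makes it agree with the real difference in \<open>loglik\<close>.\<close>
    have "?m a b \<le> ?N a b" using ab by (intro m_edges_le_n_pairs sym) auto
    then have "real (?N a b) - real (?m a b) = real (?N a b - ?m a b)" by simp
    then show "elog (\<theta> a b ^ ?m a b * (1 - \<theta> a b) ^ (?N a b - ?m a b)) =
        ereal (real (?m a b)) * elog (\<theta> a b) +
        ereal (real (?N a b) - real (?m a b)) * elog (1 - \<theta> a b)"
      by (simp only: elog_mult elog_power zero_le_power t[OF ab])
  qed
  finally show ?thesis ..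
qed

section \<open>Bernoulli inequalities and attainment of the maximum likelihood\<close>

text \<open>Gibbs' inequality. With \<open>p = m / N\<close>, apply \<open>ln t \<le> t - 1\<close>
  to the ratios \<open>x / p\<close> and \<open>(1 - x) / (1 - p)\<close>, weighted by
  \<open>m\<close> and \<open>N - m\<close>; the weighted linear bounds sum to zero.\<close>

lemma bernoulli_mle:
  fixes x :: real
  assumes "m \<le> N" "0 \<le> x" "x \<le> 1"
  shows "x ^ m * (1 - x) ^ (N - m) \<le> (real m / real N) ^ m * (1 - real m / real N) ^ (N - m)"
proof (cases "m = 0 \<or> m = N")
  \<comment> \<open>Here the frequency is 0 or 1 and has no usable logarithm, but the right-hand
    side is 1. An empty block fits too: \<open>0 / 0 = 0\<close> and all exponents vanish.\<close>
  case True
  then show ?thesis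
    using assms by (cases "N = 0") (auto intro!: power_le_one)
next
  case False
  with assms have mN: "0 < m" "m < N" by auto
  let ?p = "real m / real N"
  have p: "0 < ?p" "?p < 1" using mN by auto
  have rhs: "0 < ?p ^ m * (1 - ?p) ^ (N - m)" using p by simp
  show ?thesis
  proof (cases "x = 0 \<or> x = 1")
    case True
    then show ?thesis using mN rhs by (auto simp: power_0_left less_imp_le)
  next
    case False
    with assms have x: "0 < x" "x < 1" by auto
    have q: "1 - ?p = real (N - m) / real N"
      using mN by (simp add: diff_divide_distrib of_nat_diff)
    have x': "0 < 1 - x" and p': "0 < 1 - ?p"
      using x(2) p(2) by linarith+
    note xp = divide_pos_pos[OF x(1) p(1)] divide_pos_pos[OF x' p']
    have "real m * (x / ?p) = real N * x" using mN by simp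
    moreover have "real (N - m) * ((1 - x) / (1 - ?p)) = real N * (1 - x)"
      unfolding q using mN by simp
    moreover have "real m + real (N - m) = real N"
      using mN by simp
    ultimately have "real m * (x / ?p - 1) + real (N - m) * ((1 - x) / (1 - ?p) - 1) = 0"
      unfolding right_diff_distrib by simp
    moreover have "real m * ln (x / ?p) + real (N - m) * ln ((1 - x) / (1 - ?p))
        \<le> real m * (x / ?p - 1) + real (N - m) * ((1 - x) / (1 - ?p) - 1)"
      by (intro add_mono mult_left_mono ln_le_minus_one xp) auto
    ultimately have "real m * (ln x - ln ?p) + real (N - m) * (ln (1 - x) - ln (1 - ?p)) \<le> 0"
      unfolding ln_divide_pos[OF x(1) p(1)] ln_divide_pos[OF x' p'] by (rule ord_le_eq_trans[rotated])
    then have le: "real m * ln x + real (N - m) * ln (1 - x) \<le>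
        real m * ln ?p + real (N - m) * ln (1 - ?p)"
      unfolding right_diff_distrib by linarith
    have ln_eq: "ln (y ^ m * (1 - y) ^ (N - m)) = real m * ln y + real (N - m) * ln (1 - y)"
      if "0 < y" "y < 1" for y :: real
      using that by (subst ln_mult_pos) (auto simp only: ln_realpow zero_less_power diff_gt_0_iff_gt)
    have "ln (x ^ m * (1 - x) ^ (N - m)) \<le> ln (?p ^ m * (1 - ?p) ^ (N - m))"
      unfolding ln_eq[OF x] ln_eq[OF p] by (rule le)
    moreover have "0 < x ^ m * (1 - x) ^ (N - m)" using x by simp
    ultimately show ?thesis using rhs by (simp only: ln_le_cancel_iff)
  qed
qed

text \<open>A set of candidate estimates that does not depend on \<open>A\<close>, as a union bound
  requires. \<open>Theta\<close> leaves entries outside the index range free; the extensional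
  function space pins them down and makes the set finite.\<close>

definition grid :: "nat \<Rightarrow> nat \<Rightarrow> (nat \<times> nat \<Rightarrow> real) set" where
  "grid n K = {g \<in> ({1..K} \<times> {1..K}) \<rightarrow>\<^sub>E (\<lambda>(m, N). real m / real N) ` ({..n\<^sup>2} \<times> {..n\<^sup>2}).
     curry g \<in> Theta K}"

lemma finite_grid [simp]: "finite (grid n K)"
  unfolding grid_def
  by (rule finite_subset[of _ "({1..K} \<times> {1..K}) \<rightarrow>\<^sub>E (\<lambda>(m, N). real m / real N) ` ({..n\<^sup>2} \<times> {..n\<^sup>2})"])
    (blast, auto intro!: finite_PiE)

text \<open>A crude count, with numerator and denominator chosen freely in each of the
  \<open>K\<^sup>2\<close> entries; its logarithm is still only of order
  \<open>K\<^sup>2 ln n\<close>.\<close>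

lemma card_grid_le: "card (grid n K) \<le> (n\<^sup>2 + 1) ^ (2 * K\<^sup>2)"
proof -
  let ?Q = "(\<lambda>(m, N). real m / real N) ` ({..n\<^sup>2} \<times> {..n\<^sup>2})"
  have "card (grid n K) \<le> card (({1..K} \<times> {1..K}) \<rightarrow>\<^sub>E ?Q)"
    unfolding grid_def by (rule card_mono) (auto intro!: finite_PiE)
  also have "\<dots> = card ?Q ^ K\<^sup>2"
    by (subst card_PiE) (auto simp: power2_eq_square)
  also have "\<dots> \<le> ((n\<^sup>2 + 1)\<^sup>2) ^ K\<^sup>2"
  proof (rule power_mono)
    have "card ?Q \<le> card ({..n\<^sup>2} \<times> {..n\<^sup>2})" by (rule card_image_le) auto
    then show "card ?Q \<le> (n\<^sup>2 + 1)\<^sup>2" by (simp add: power2_eq_square)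
  qed auto
  finally show ?thesis by (simp add: power_mult)
qed

text \<open>The blocks have separate parameters, so each factor can be maximised on its own by
  \<open>bernoulli_mle\<close>; the observed block frequencies are the joint maximiser.\<close>

lemma sup_loglik_attained_on_grid:
  assumes sym: "\<And>i j. A i j = A j i" and z: "z \<in> labels n K"
  obtains g where "g \<in> grid n K" "sup_loglik n K A z = elog (lik n A (curry g) z)"
proof -
  let ?m = "m_edges n A z" and ?N = "n_pairs n z"
  \<comment> \<open>Sorting the indices makes the matrix symmetric and brings them into the range
    \<open>a \<le> b\<close> of the counting lemmas. An empty block receives the value
    \<open>0 / 0 = 0\<close>.\<close>
  define g where "g = restrict (\<lambda>(a, b). real (?m (min a b) (max a b)) / real (?N (min a b) (max a b)))
    ({1..K} \<times> {1..K})"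
  have mN: "?m a b \<le> ?N a b" "?N a b \<le> n\<^sup>2" if "a \<le> b" for a b
    using that by (auto intro!: m_edges_le_n_pairs sym n_pairs_le)
  have th: "curry g \<in> Theta K"
    using mN by (auto simp: g_def Theta_def min.commute max.commute intro!: divide_le_eq_1[THEN iffD2])
  have g: "g \<in> grid n K"
    unfolding grid_def
  proof (intro CollectI conjI th)
    show "g \<in> {1..K} \<times> {1..K} \<rightarrow>\<^sub>E (\<lambda>(m, N). real m / real N) ` ({..n\<^sup>2} \<times> {..n\<^sup>2})"
    proof (rule PiE_I)
      fix e assume e: "e \<in> {1..K} \<times> {1..K}"
      obtain a b where ab: "e = (a, b)" by (cases e)
      have "min a b \<le> max a b" by simp
      from mN[OF this] show "g e \<in> (\<lambda>(m, N). real m / real N) ` ({..n\<^sup>2} \<times> {..n\<^sup>2})"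
        using e ab by (intro image_eqI[of _ _ "(?m (min a b) (max a b), ?N (min a b) (max a b))"])
          (auto simp: g_def)
    qed (auto simp: g_def)
  qed
  have "sup_loglik n K A z = elog (lik n A (curry g) z)"
    unfolding sup_loglik_def
  proof (rule antisym)
    show "(SUP \<theta>\<in>Theta K. loglik n K A \<theta> z) \<le> elog (lik n A (curry g) z)"
    proof (rule SUP_least)
      fix \<theta> assume t: "\<theta> \<in> Theta K"
      have nn: "0 \<le> lik n A \<theta> z" if "\<theta> \<in> Theta K" for \<theta>
        using that z by (auto simp: lik_eq_prod_blocks[of A, OF sym that z] Theta_def intro!: prod_nonneg)
      have "lik n A \<theta> z \<le> lik n A (curry g) z"
        unfolding lik_eq_prod_blocks[of A, OF sym t z] lik_eq_prod_blocks[of A, OF sym th z]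
      proof (intro prod_mono conjI prod_nonneg ballI)
        fix a b assume ab: "a \<in> {1..K}" "b \<in> {a..K}"
        then have x: "0 \<le> \<theta> a b" "\<theta> a b \<le> 1" using t by (auto simp: Theta_def)
        then show "0 \<le> \<theta> a b ^ ?m a b * (1 - \<theta> a b) ^ (?N a b - ?m a b)" by simp
        show "\<theta> a b ^ ?m a b * (1 - \<theta> a b) ^ (?N a b - ?m a b) \<le>
            curry g a b ^ ?m a b * (1 - curry g a b) ^ (?N a b - ?m a b)"
          using bernoulli_mle[OF mN(1) x] ab by (simp add: g_def min_absorb1 max_absorb2)
      qed (use t in \<open>auto simp: Theta_def\<close>)
      then show "loglik n K A \<theta> z \<le> elog (lik n A (curry g) z)"
        using nn[OF t] nn[OF th] by (simp add: loglik_eq_elog_lik[of A, OF sym t z] elog_le_iff)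
    qed
    show "elog (lik n A (curry g) z) \<le> (SUP \<theta>\<in>Theta K. loglik n K A \<theta> z)"
      unfolding loglik_eq_elog_lik[of A, OF sym th z, symmetric] by (rule SUP_upper) (rule th)
  qed
  with g show thesis by (rule that)
qed

text \<open>The left-hand side is the Hellinger affinity, that is, 1 minus half the sum of the
  squared differences of the square roots. On the unit interval
  \<open>sqrt x + sqrt y \<le> 2\<close>, so each of those two squares is at least
  \<open>(p - q)\<^sup>2 / 4\<close>.\<close>

lemma bernoulli_affinity_le:
  fixes p q :: real
  assumes "0 \<le> p" "p \<le> 1" "0 \<le> q" "q \<le> 1"
  shows "sqrt (p * q) + sqrt ((1 - p) * (1 - q)) \<le> exp (- (p - q)\<^sup>2 / 4)"
proof -
  have key: "(x - y)\<^sup>2 \<le> 4 * (sqrt x - sqrt y)\<^sup>2"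
    if "0 \<le> x" "x \<le> 1" "0 \<le> y" "y \<le> 1" for x y :: real
  proof -
    have "x - y = (sqrt x - sqrt y) * (sqrt x + sqrt y)"
      using that by (simp add: algebra_simps)
    then have "(x - y)\<^sup>2 = (sqrt x - sqrt y)\<^sup>2 * (sqrt x + sqrt y)\<^sup>2"
      by (simp add: power_mult_distrib)
    also have "\<dots> \<le> (sqrt x - sqrt y)\<^sup>2 * 2\<^sup>2"
    proof (intro mult_left_mono power_mono)
      have "sqrt x \<le> 1" "sqrt y \<le> 1" using that by auto
      then show "sqrt x + sqrt y \<le> 2" by linarith
    qed (use that in auto)
    finally show ?thesis by simp
  qed
  have e: "(sqrt x - sqrt y)\<^sup>2 = x + y - 2 * sqrt (x * y)" if "0 \<le> x" "0 \<le> y" for x y :: real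
    using that by (simp add: power2_diff real_sqrt_mult)
  have "(1 - p - (1 - q))\<^sup>2 = (p - q)\<^sup>2" by (simp add: power2_eq_square algebra_simps)
  with key[of p q] key[of "1 - p" "1 - q"] e[of p q] e[of "1 - p" "1 - q"] assms
  have "sqrt (p * q) + sqrt ((1 - p) * (1 - q)) \<le> 1 + (- (p - q)\<^sup>2 / 4)" by simp
  also have "\<dots> \<le> exp (- (p - q)\<^sup>2 / 4)" by (rule exp_ge_add_one_self)
  finally show ?thesis .
qed

lemma max_loglik_attained:
  assumes sym: "\<And>i j. A i j = A j i" and "1 \<le> K"
  obtains w g where "w \<in> labels n K" "g \<in> grid n K" "max_loglik n K A = elog (lik n A (curry g) w)"
proof -
  have "finite (labels n K)" "labels n K \<noteq> {}"
    using \<open>1 \<le> K\<close> by (auto simp: labels_def PiE_eq_empty_iff intro!: finite_PiE)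
  then have "max_loglik n K A \<in> sup_loglik n K A ` labels n K"
    unfolding max_loglik_def by (intro Max_in) auto
  then obtain w where w: "w \<in> labels n K" "max_loglik n K A = sup_loglik n K A w" by auto
  obtain g where "g \<in> grid n K" "sup_loglik n K A w = elog (lik n A (curry g) w)"
    by (rule sup_loglik_attained_on_grid[of A, OF sym w(1)])
  with w that show thesis by simp
qed

lemma sup_loglik_le_max_loglik:
  assumes "w \<in> labels n K"
  shows "sup_loglik n K A w \<le> max_loglik n K A"
  unfolding max_loglik_def using assms by (intro Max_ge) (auto simp: labels_def intro!: finite_PiE)

lemma loglik_le_max_loglik:
  assumes "\<theta> \<in> Theta K" "w \<in> labels n K"
  shows "loglik n K A \<theta> w \<le> max_loglik n K A"
proof -
  have "loglik n K A \<theta> w \<le> sup_loglik n K A w"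
    unfolding sup_loglik_def using assms by (intro SUP_upper)
  with sup_loglik_le_max_loglik[OF assms(2)] show ?thesis by (rule order_trans[rotated])
qed

section \<open>Positivity of the likelihood and expectations under the model\<close>

lemma label_pair:
  assumes "z \<in> labels n K" "(i, j) \<in> pairs n"
  shows "z i \<in> {1..K}" "z j \<in> {1..K}"
  using assms by (auto simp: labels_def pairs_def)

lemma lik_pos:
  assumes "\<And>i j. (i, j) \<in> pairs n \<Longrightarrow> 0 < \<theta> (z i) (z j) \<and> \<theta> (z i) (z j) < 1"
  shows "0 < lik n A \<theta> z"
  unfolding lik_def using assms by (intro prod_pos) auto

lemma lik_nonneg:
  assumes "\<And>i j. (i, j) \<in> pairs n \<Longrightarrow> 0 \<le> \<theta> (z i) (z j) \<and> \<theta> (z i) (z j) \<le> 1"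
  shows "0 \<le> lik n A \<theta> z"
  unfolding lik_def using assms by (intro prod_nonneg) auto

lemma sbm_sym:
  assumes "A \<in> set_pmf (sbm n \<theta> z)"
  shows "A i j = A j i"
  using assms by (auto simp: sbm_def min.commute max.commute)

text \<open>Finite support makes every real function integrable, which discharges the side
  conditions of all integral estimates below.\<close>

lemma finite_set_sbm: "finite (set_pmf (sbm n \<theta> z))"
proof -
  have "finite (PiE_dflt (pairs n) False (set_pmf \<circ> (\<lambda>(i, j). bernoulli_pmf (\<theta> (z i) (z j)))))"
    by (rule finite_PiE_dflt[OF finite_pairs finite])
  then show ?thesis
    unfolding sbm_def pairs_def[symmetric] set_map_pmf set_Pi_pmf[OF finite_pairs] by (rule finite_imageI)
qed

lemma integrable_sbm [simp]:
  fixes f :: "_ \<Rightarrow> real"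
  shows "integrable (measure_pmf (sbm n \<theta> z)) f"
  by (intro integrable_measure_pmf_finite finite_set_sbm)

lemma expectation_sbm_prod:
  fixes f :: "nat \<times> nat \<Rightarrow> bool \<Rightarrow> real"
  assumes p: "\<And>i j. (i, j) \<in> pairs n \<Longrightarrow> 0 \<le> \<theta> (z i) (z j) \<and> \<theta> (z i) (z j) \<le> 1"
    and f: "\<And>e b. e \<in> pairs n \<Longrightarrow> 0 \<le> f e b"
  shows "measure_pmf.expectation (sbm n \<theta> z) (\<lambda>A. \<Prod>(i, j)\<in>pairs n. f (i, j) (A i j)) =
    (\<Prod>(i, j)\<in>pairs n. f (i, j) True * \<theta> (z i) (z j) + f (i, j) False * (1 - \<theta> (z i) (z j)))"
proof -
  let ?p = "\<lambda>(i, j). bernoulli_pmf (\<theta> (z i) (z j))"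
  have "measure_pmf.expectation (sbm n \<theta> z) (\<lambda>A. \<Prod>(i, j)\<in>pairs n. f (i, j) (A i j)) =
      measure_pmf.expectation (Pi_pmf (pairs n) False ?p)
        (\<lambda>B. \<Prod>(i, j)\<in>pairs n. f (i, j) (B (min i j, max i j)))"
    by (simp add: sbm_def pairs_def)
  \<comment> \<open>The product only visits pairs with \<open>i < j\<close>, where the
    symmetrisation by \<open>min\<close> and \<open>max\<close> changes nothing; independence then
    applies to the raw coordinates.\<close>
  also have "\<dots> = measure_pmf.expectation (Pi_pmf (pairs n) False ?p) (\<lambda>B. \<Prod>e\<in>pairs n. f e (B e))"
    by (intro arg_cong[where f = "measure_pmf.expectation _"] ext prod.cong refl)
      (auto simp: pairs_def min_def max_def)
  also have "\<dots> = (\<Prod>e\<in>pairs n. measure_pmf.expectation (?p e) (f e))"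
    by (intro expectation_prod_Pi_pmf finite_pairs f integrable_measure_pmf_finite finite)
  also have "\<dots> = (\<Prod>(i, j)\<in>pairs n. f (i, j) True * \<theta> (z i) (z j) + f (i, j) False * (1 - \<theta> (z i) (z j)))"
    using p by (intro prod.cong refl) auto
  finally show ?thesis .
qed

section \<open>Tail and divergence bounds for one fixed competitor\<close>

text \<open>The quantity \<open>D\<close> of the outline. Comparing edge by edge needs no matching
  of communities, so the two parameters may have different numbers of them.\<close>

definition sq_dist ::
    "nat \<Rightarrow> (nat \<Rightarrow> nat \<Rightarrow> real) \<Rightarrow> (nat \<Rightarrow> nat) \<Rightarrow> (nat \<Rightarrow> nat \<Rightarrow> real) \<Rightarrow> (nat \<Rightarrow> nat) \<Rightarrow> real" where
  "sq_dist n \<theta> z \<eta> w = (\<Sum>(i, j)\<in>pairs n. (\<theta> (z i) (z j) - \<eta> (w i) (w j))\<^sup>2)"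

text \<open>The likelihood ratio itself has expectation 1, so Markov's inequality applied to it
  would not see the distance. Its square root has the product of the edgewise affinities as
  expectation, and that decays with \<open>sq_dist\<close>.\<close>

lemma prob_lik_gt_le:
  assumes p: "\<And>i j. (i, j) \<in> pairs n \<Longrightarrow> 0 < \<theta> (z i) (z j) \<and> \<theta> (z i) (z j) < 1"
    and q: "\<And>i j. (i, j) \<in> pairs n \<Longrightarrow> 0 \<le> \<eta> (w i) (w j) \<and> \<eta> (w i) (w j) \<le> 1"
  shows "measure_pmf.prob (sbm n \<theta> z) {A. lik n A \<eta> w > exp (- t) * lik n A \<theta> z}
    \<le> exp (t / 2 - sq_dist n \<theta> z \<eta> w / 4)"
proof -
  let ?M = "measure_pmf (sbm n \<theta> z)"
  let ?S = "{A. lik n A \<eta> w > exp (- t) * lik n A \<theta> z}"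
  let ?R = "\<lambda>A. sqrt (lik n A \<eta> w / lik n A \<theta> z)"
  define f where "f = (\<lambda>(i, j) b. sqrt ((if b then \<eta> (w i) (w j) else 1 - \<eta> (w i) (w j)) /
    (if b then \<theta> (z i) (z j) else 1 - \<theta> (z i) (z j))))"
  have Rf: "?R A = (\<Prod>(i, j)\<in>pairs n. f (i, j) (A i j))" for A
  proof -
    have "sqrt (\<Prod>x\<in>S. h x) = (\<Prod>x\<in>S. sqrt (h x))" if "finite S" for S :: "(nat \<times> nat) set" and h
      using that by (induction rule: finite_induct) (auto simp: real_sqrt_mult)
    from this[OF finite_pairs] show ?thesis
      unfolding lik_def f_def by (subst prod_dividef[symmetric]) (auto intro!: prod.cong)
  qed
  have "integral\<^sup>L ?M ?R = (\<Prod>(i, j)\<in>pairs n. f (i, j) True * \<theta> (z i) (z j) + f (i, j) False * (1 - \<theta> (z i) (z j)))"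
    unfolding Rf
  proof (rule expectation_sbm_prod)
    show "0 \<le> f e b" if "e \<in> pairs n" for e b
      using that p[of "fst e" "snd e"] q[of "fst e" "snd e"] by (cases e) (auto simp: f_def)
  qed (use p in \<open>auto simp: less_imp_le\<close>)
  also have "\<dots> \<le> (\<Prod>(i, j)\<in>pairs n. exp (- (\<theta> (z i) (z j) - \<eta> (w i) (w j))\<^sup>2 / 4))"
  proof (rule prod_mono, clarify)
    fix i j assume "(i, j) \<in> pairs n"
    note pq = p[OF this] q[OF this]
    \<comment> \<open>Weighting the root of the ratio by the true probability produces the geometric
      mean that appears in the affinity.\<close>
    have s: "sqrt (y / x) * x = sqrt (x * y)" if "0 < x" "0 \<le> y" for x y :: real
      using that by (simp add: real_sqrt_divide real_sqrt_mult field_simps)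
    have "f (i, j) True * \<theta> (z i) (z j) + f (i, j) False * (1 - \<theta> (z i) (z j)) =
        sqrt (\<theta> (z i) (z j) * \<eta> (w i) (w j)) + sqrt ((1 - \<theta> (z i) (z j)) * (1 - \<eta> (w i) (w j)))"
      using pq by (simp add: f_def s)
    moreover have "\<dots> \<le> exp (- (\<theta> (z i) (z j) - \<eta> (w i) (w j))\<^sup>2 / 4)"
      using pq by (intro bernoulli_affinity_le) auto
    moreover have "0 \<le> sqrt (\<theta> (z i) (z j) * \<eta> (w i) (w j)) + sqrt ((1 - \<theta> (z i) (z j)) * (1 - \<eta> (w i) (w j)))"
      using pq by (intro add_nonneg_nonneg) auto
    ultimately show "0 \<le> f (i, j) True * \<theta> (z i) (z j) + f (i, j) False * (1 - \<theta> (z i) (z j)) \<and>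
        f (i, j) True * \<theta> (z i) (z j) + f (i, j) False * (1 - \<theta> (z i) (z j))
        \<le> exp (- (\<theta> (z i) (z j) - \<eta> (w i) (w j))\<^sup>2 / 4)"
      by simp
  qed
  also have "\<dots> = exp (- sq_dist n \<theta> z \<eta> w / 4)"
    by (simp add: sq_dist_def exp_sum[symmetric] case_prod_beta sum_negf[symmetric] sum_divide_distrib)
  finally have ER: "integral\<^sup>L ?M ?R \<le> exp (- sq_dist n \<theta> z \<eta> w / 4)" .
  have "measure ?M ?S = (\<integral>A. indicator ?S A \<partial>?M)" by simp
  \<comment> \<open>Markov's inequality written out: on the event the integrand on the right is at
    least 1, elsewhere it is nonnegative.\<close>
  also have "\<dots> \<le> (\<integral>A. exp (t / 2) * ?R A \<partial>?M)"
  proof (rule integral_mono)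
    fix A
    have pos: "0 < lik n A \<theta> z" using p by (rule lik_pos)
    have "0 \<le> lik n A \<eta> w" using q by (rule lik_nonneg)
    then have nn: "0 \<le> exp (t / 2) * ?R A" using pos by simp
    show "indicator ?S A \<le> exp (t / 2) * ?R A"
    proof (cases "A \<in> ?S")
      case True
      then have "exp (- t) \<le> lik n A \<eta> w / lik n A \<theta> z"
        using pos by (simp add: pos_le_divide_eq)
      then have "sqrt (exp (- t)) \<le> ?R A" by (rule real_sqrt_le_mono)
      moreover have "sqrt (exp (- t)) = exp (- t / 2)"
        by (rule real_sqrt_unique) (auto simp: exp_of_nat_mult[symmetric])
      ultimately have "exp (t / 2) * exp (- t / 2) \<le> exp (t / 2) * ?R A"
        by (intro mult_left_mono) auto
      then show ?thesis using True by (simp add: exp_add[symmetric])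
    qed (use nn in simp)
  qed simp_all
  also have "\<dots> \<le> exp (t / 2) * exp (- sq_dist n \<theta> z \<eta> w / 4)"
    using ER by simp
  finally show ?thesis by (simp add: exp_add[symmetric])
qed

text \<open>Jensen's inequality reduces the Kullback--Leibler divergence to the chi-square divergence,
  which factorizes over the edges.\<close>

lemma expectation_ln_lik_ratio_ge:
  assumes p: "\<And>i j. (i, j) \<in> pairs n \<Longrightarrow> 0 < \<theta> (z i) (z j) \<and> \<theta> (z i) (z j) < 1"
    and q: "\<And>i j. (i, j) \<in> pairs n \<Longrightarrow> c \<le> \<eta> (w i) (w j) \<and> \<eta> (w i) (w j) \<le> 1 - c"
    and c: "0 < c"
  shows "- sq_dist n \<theta> z \<eta> w / c\<^sup>2
    \<le> measure_pmf.expectation (sbm n \<theta> z) (\<lambda>A. ln (lik n A \<eta> w / lik n A \<theta> z))"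
proof -
  let ?M = "measure_pmf (sbm n \<theta> z)"
  let ?R = "\<lambda>A. lik n A \<theta> z / lik n A \<eta> w"
  let ?s = "sq_dist n \<theta> z \<eta> w / c\<^sup>2"
  define f where "f = (\<lambda>(i, j) b. (if b then \<theta> (z i) (z j) else 1 - \<theta> (z i) (z j)) /
    (if b then \<eta> (w i) (w j) else 1 - \<eta> (w i) (w j)))"
  have q01: "0 < \<eta> (w i) (w j) \<and> \<eta> (w i) (w j) < 1" if "(i, j) \<in> pairs n" for i j
    using q[OF that] c by auto
  have Rf: "?R A = (\<Prod>(i, j)\<in>pairs n. f (i, j) (A i j))" for A
    unfolding lik_def f_def by (subst prod_dividef[symmetric]) (auto intro!: prod.cong)
  have "integral\<^sup>L ?M ?R = (\<Prod>(i, j)\<in>pairs n. f (i, j) True * \<theta> (z i) (z j) + f (i, j) False * (1 - \<theta> (z i) (z j)))"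
    unfolding Rf
  proof (rule expectation_sbm_prod)
    show "0 \<le> f e b" if "e \<in> pairs n" for e b
      using that p[of "fst e" "snd e"] q01[of "fst e" "snd e"] by (cases e) (auto simp: f_def)
  qed (use p in \<open>auto simp: less_imp_le\<close>)
  also have "\<dots> \<le> (\<Prod>(i, j)\<in>pairs n. exp ((\<theta> (z i) (z j) - \<eta> (w i) (w j))\<^sup>2 / c\<^sup>2))"
  proof (rule prod_mono, clarify)
    fix i j assume "(i, j) \<in> pairs n"
    note pq = p[OF this] q[OF this] q01[OF this]
    define x where "x = \<theta> (z i) (z j)"
    define y where "y = \<eta> (w i) (w j)"
    have x: "0 < x" "x < 1" and y: "0 < y" "y < 1" "c \<le> y" "y \<le> 1 - c"
      using pq by (auto simp: x_def y_def)
    have eq: "f (i, j) True * x + f (i, j) False * (1 - x) = x\<^sup>2 / y + (1 - x)\<^sup>2 / (1 - y)"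
      by (simp add: f_def x_def y_def power2_eq_square)
    \<comment> \<open>The chi-square divergence of two Bernoulli laws; its denominator is at least
      \<open>c\<^sup>2\<close> because \<open>y\<close> stays in \<open>[c, 1 - c]\<close>.\<close>
    also have "x\<^sup>2 / y + (1 - x)\<^sup>2 / (1 - y) = 1 + (x - y)\<^sup>2 / (y * (1 - y))"
    proof -
      have "x\<^sup>2 / y + (1 - x)\<^sup>2 / (1 - y) = (x\<^sup>2 * (1 - y) + (1 - x)\<^sup>2 * y) / (y * (1 - y))"
        using y by (subst add_frac_eq) auto
      also have "x\<^sup>2 * (1 - y) + (1 - x)\<^sup>2 * y = y * (1 - y) + (x - y)\<^sup>2"
        by (simp add: power2_eq_square algebra_simps)
      also have "(y * (1 - y) + (x - y)\<^sup>2) / (y * (1 - y)) = 1 + (x - y)\<^sup>2 / (y * (1 - y))"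
        using y by (subst add_divide_distrib) auto
      finally show ?thesis .
    qed
    also have "\<dots> \<le> 1 + (x - y)\<^sup>2 / c\<^sup>2"
    proof -
      have "c * c \<le> y * (1 - y)" using y c by (intro mult_mono) auto
      then show ?thesis
        using c y by (intro add_left_mono divide_left_mono) (auto simp: power2_eq_square)
    qed
    also have "\<dots> \<le> exp ((x - y)\<^sup>2 / c\<^sup>2)" by (rule exp_ge_add_one_self)
    finally have le: "f (i, j) True * x + f (i, j) False * (1 - x) \<le> exp ((x - y)\<^sup>2 / c\<^sup>2)" .
    have "0 \<le> f (i, j) True * x + f (i, j) False * (1 - x)"
      unfolding eq using x y by (intro add_nonneg_nonneg) auto
    with le show "0 \<le> f (i, j) True * \<theta> (z i) (z j) + f (i, j) False * (1 - \<theta> (z i) (z j)) \<and>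
        f (i, j) True * \<theta> (z i) (z j) + f (i, j) False * (1 - \<theta> (z i) (z j))
        \<le> exp ((\<theta> (z i) (z j) - \<eta> (w i) (w j))\<^sup>2 / c\<^sup>2)"
      by (simp add: x_def y_def)
  qed
  also have "\<dots> = exp ?s"
    by (simp add: sq_dist_def exp_sum[symmetric] case_prod_beta sum_divide_distrib)
  finally have ER: "integral\<^sup>L ?M ?R \<le> exp ?s" .
  \<comment> \<open>Jensen's inequality by hand: the logarithm of \<open>?R A\<close> lies below its
    tangent at \<open>exp ?s\<close>, and the bound on the expectation of the ratio makes the
    tangent integrate to at most \<open>?s\<close>.\<close>
  have "(\<integral>A. - ln (lik n A \<eta> w / lik n A \<theta> z) \<partial>?M) \<le> (\<integral>A. ?R A * exp (- ?s) + (?s - 1) \<partial>?M)"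
  proof (rule integral_mono)
    fix A
    have pos: "0 < lik n A \<theta> z" "0 < lik n A \<eta> w" using p q01 by (auto intro!: lik_pos)
    have "ln (?R A * exp (- ?s)) \<le> ?R A * exp (- ?s) - 1"
      using pos by (intro ln_le_minus_one) simp
    moreover have "ln (?R A * exp (- ?s)) = ln (?R A) - ?s"
      using pos by (subst ln_mult_pos) auto
    moreover have "ln (?R A) = - ln (lik n A \<eta> w / lik n A \<theta> z)"
      using pos by (simp add: ln_divide_pos)
    ultimately show "- ln (lik n A \<eta> w / lik n A \<theta> z) \<le> ?R A * exp (- ?s) + (?s - 1)" by linarith
  qed simp_all
  also have "\<dots> = integral\<^sup>L ?M ?R * exp (- ?s) + (?s - 1)"
    by (subst Bochner_Integration.integral_add) (simp_all only: integral_mult_left_zero integrable_sbm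
      measure_pmf.prob_space lebesgue_integral_const scaleR_one)
  also have "\<dots> \<le> exp ?s * exp (- ?s) + (?s - 1)"
    using ER by (intro add_right_mono mult_right_mono) auto
  also have "\<dots> = ?s" by (simp add: exp_add[symmetric])
  finally show ?thesis by simp
qed

section \<open>From the expected likelihood ratio to a union bound\<close>

text \<open>Every fixed pair \<open>(\<eta>, w)\<close> competes in the maximum. The positivity
  hypotheses make \<open>LR\<close> finite, so that \<open>real_of_ereal\<close> does not replace an
  infinite value by 0.\<close>

lemma real_of_LR_ge:
  assumes sym: "\<And>i j. A i j = A j i"
    and th: "\<theta> \<in> Theta K" "z \<in> labels n K"
    and eta: "\<eta> \<in> Theta K'" "w \<in> labels n K'"
    and K': "1 \<le> K'"
    and pos: "0 < lik n A \<theta> z" "0 < lik n A \<eta> w"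
  shows "ln (lik n A \<eta> w / lik n A \<theta> z) \<le> real_of_ereal (LR n K K' \<theta> z A)"
proof -
  obtain v g where v: "v \<in> labels n K'" "g \<in> grid n K'" "max_loglik n K' A = elog (lik n A (curry g) v)"
    by (rule max_loglik_attained[of A, OF sym K'])
  let ?x = "lik n A (curry g) v"
  have "ereal (ln (lik n A \<eta> w)) \<le> elog ?x"
    using loglik_le_max_loglik[OF eta, of A] pos(2)
    by (simp add: v(3) loglik_eq_elog_lik[of A, OF sym eta] elog_def)
  then have x: "?x \<noteq> 0" "ln (lik n A \<eta> w) \<le> ln ?x"
    by (auto simp: elog_def split: if_splits)
  have "LR n K K' \<theta> z A = ereal (ln ?x - ln (lik n A \<theta> z))"
    using pos(1) x(1) by (simp add: LR_def v(3) loglik_eq_elog_lik[of A, OF sym th] elog_def)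
  then show ?thesis using x(2) pos by (simp add: ln_divide_pos)
qed

text \<open>Clamping \<open>\<eta>\<close> to the range of the true matrix only decreases its distance to the latter,
  so \<open>\<eta>\<close> itself may take the values 0 and 1.\<close>

lemma mu_ge_sq_dist:
  assumes c: "0 < c" "c \<le> 1 / 2" and n: "1 \<le> n"
    and th: "\<theta> \<in> Theta K" "z \<in> labels n K"
    and bd: "\<And>a b. a \<in> {1..K} \<Longrightarrow> b \<in> {1..K} \<Longrightarrow> c \<le> \<theta> a b \<and> \<theta> a b \<le> 1 - c"
    and eta: "\<eta> \<in> Theta K'" "w \<in> labels n K'" and K': "1 \<le> K'"
  shows "- sq_dist n \<theta> z \<eta> w / c\<^sup>2 \<le> (real n)\<^sup>2 * mu n K K' \<theta> z"
proof -
  let ?M = "measure_pmf (sbm n \<theta> z)"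
  define \<eta>' where "\<eta>' = (\<lambda>a b. max c (min (1 - c) (\<eta> a b)))"
  have eta': "\<eta>' \<in> Theta K'" using eta(1) c by (auto simp: Theta_def \<eta>'_def)
  have p: "c \<le> \<theta> (z i) (z j) \<and> \<theta> (z i) (z j) \<le> 1 - c" if "(i, j) \<in> pairs n" for i j
    using label_pair[OF th(2) that] by (intro bd)
  then have p01: "0 < \<theta> (z i) (z j) \<and> \<theta> (z i) (z j) < 1" if "(i, j) \<in> pairs n" for i j
    using p[OF that] c by auto
  have q: "c \<le> \<eta>' a b \<and> \<eta>' a b \<le> 1 - c" for a b using c by (auto simp: \<eta>'_def)
  then have q01: "0 < \<eta>' a b \<and> \<eta>' a b < 1" for a b using q[of a b] c by (intro conjI) linarith+
  have "sq_dist n \<theta> z \<eta>' w \<le> sq_dist n \<theta> z \<eta> w"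
    unfolding sq_dist_def
  proof (rule sum_mono, clarify)
    fix i j assume "(i, j) \<in> pairs n"
    from p[OF this] have "\<bar>\<theta> (z i) (z j) - \<eta>' (w i) (w j)\<bar> \<le> \<bar>\<theta> (z i) (z j) - \<eta> (w i) (w j)\<bar>"
      by (auto simp: \<eta>'_def)
    then show "(\<theta> (z i) (z j) - \<eta>' (w i) (w j))\<^sup>2 \<le> (\<theta> (z i) (z j) - \<eta> (w i) (w j))\<^sup>2"
      by (simp add: abs_le_square_iff)
  qed
  then have "- sq_dist n \<theta> z \<eta> w / c\<^sup>2 \<le> - sq_dist n \<theta> z \<eta>' w / c\<^sup>2"
    by (intro divide_right_mono) auto
  also have "\<dots> \<le> (\<integral>A. ln (lik n A \<eta>' w / lik n A \<theta> z) \<partial>?M)"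
    using p01 q c by (intro expectation_ln_lik_ratio_ge)
  also have "\<dots> \<le> (\<integral>A. real_of_ereal (LR n K K' \<theta> z A) \<partial>?M)"
  proof (rule integral_mono_AE)
    show "AE A in ?M. ln (lik n A \<eta>' w / lik n A \<theta> z) \<le> real_of_ereal (LR n K K' \<theta> z A)"
    proof (rule AE_pmfI)
      fix A assume "A \<in> set_pmf (sbm n \<theta> z)"
      then show "ln (lik n A \<eta>' w / lik n A \<theta> z) \<le> real_of_ereal (LR n K K' \<theta> z A)"
        using p01 q01 by (intro real_of_LR_ge th eta' eta(2) K' lik_pos sbm_sym)
    qed
  qed simp_all
  also have "\<dots> = (real n)\<^sup>2 * mu n K K' \<theta> z"
    using n by (simp add: mu_def)
  finally show ?thesis .
qed

text \<open>By \<open>mu_ge_sq_dist\<close> one bound in terms of \<open>mu\<close> serves all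
  competitors at once, so the union bound is that bound times the number of label vectors and grid
  matrices.\<close>

lemma prob_LR_gt_le:
  assumes c: "0 < c" "c \<le> 1 / 2" and n: "1 \<le> n"
    and th: "\<theta> \<in> Theta K" "z \<in> labels n K"
    and bd: "\<And>a b. a \<in> {1..K} \<Longrightarrow> b \<in> {1..K} \<Longrightarrow> c \<le> \<theta> a b \<and> \<theta> a b \<le> 1 - c"
    and K': "1 \<le> K'"
  shows "measure_pmf.prob (sbm n \<theta> z) {A. LR n K K' \<theta> z A > ereal (- t)}
    \<le> real K' ^ n * real (n\<^sup>2 + 1) ^ (2 * K'\<^sup>2) * exp (t / 2 + c\<^sup>2 * (real n)\<^sup>2 * mu n K K' \<theta> z / 4)"
proof -
  let ?M = "measure_pmf (sbm n \<theta> z)"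
  let ?B = "exp (t / 2 + c\<^sup>2 * (real n)\<^sup>2 * mu n K K' \<theta> z / 4)"
  define E where "E = (\<lambda>(w, g). {A. lik n A (curry g) w > exp (- t) * lik n A \<theta> z})"
  let ?I = "labels n K' \<times> grid n K'"
  have fin: "finite ?I" by (auto simp: labels_def intro!: finite_PiE)
  have p01: "0 < \<theta> (z i) (z j) \<and> \<theta> (z i) (z j) < 1" if "(i, j) \<in> pairs n" for i j
    using bd[OF label_pair[OF th(2) that]] c by auto
  \<comment> \<open>The maximiser depends on \<open>A\<close> but always lies in the finite index
    set, so the event is covered by the fixed events \<open>E\<close>.\<close>
  have "measure ?M {A. LR n K K' \<theta> z A > ereal (- t)} \<le> measure ?M (\<Union>i\<in>?I. E i)"
  proof (rule measure_pmf.finite_measure_mono_AE)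
    show "AE A in ?M. A \<in> {A. LR n K K' \<theta> z A > ereal (- t)} \<longrightarrow> A \<in> (\<Union>i\<in>?I. E i)"
    proof (rule AE_pmfI, rule impI)
      fix A assume A: "A \<in> set_pmf (sbm n \<theta> z)" "A \<in> {A. LR n K K' \<theta> z A > ereal (- t)}"
      note sym = sbm_sym[OF A(1)]
      obtain v g where v: "v \<in> labels n K'" "g \<in> grid n K'" "max_loglik n K' A = elog (lik n A (curry g) v)"
        by (rule max_loglik_attained[of A, OF sym K'])
      let ?x = "lik n A (curry g) v" and ?y = "lik n A \<theta> z"
      have y: "0 < ?y" using p01 by (rule lik_pos)
      have th_g: "curry g \<in> Theta K'" using v(2) by (simp add: grid_def)
      have x: "0 \<le> ?x"
      proof (rule lik_nonneg)
        fix i j assume "(i, j) \<in> pairs n"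
        from label_pair[OF v(1) this] th_g
        show "0 \<le> curry g (v i) (v j) \<and> curry g (v i) (v j) \<le> 1" unfolding Theta_def by blast
      qed
      have gt: "elog ?x - ereal (ln ?y) > ereal (- t)"
        using A(2) y by (simp add: LR_def v(3) loglik_eq_elog_lik[of A, OF sym th] elog_def)
      then have "?x \<noteq> 0" by (auto simp: elog_def)
      with x gt have "0 < ?x" "- t + ln ?y < ln ?x" by (auto simp: elog_def)
      then have "exp (- t + ln ?y) < exp (ln ?x)" by (simp only: exp_less_cancel_iff)
      then have "exp (- t) * ?y < ?x" using y \<open>0 < ?x\<close> by (simp only: exp_add exp_ln)
      then show "A \<in> (\<Union>i\<in>?I. E i)" using v(1,2) by (auto simp: E_def)
    qed
  qed simp
  also have "\<dots> \<le> (\<Sum>i\<in>?I. measure ?M (E i))"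
    by (rule measure_UNION_le[OF fin]) simp
  also have "\<dots> \<le> (\<Sum>i\<in>?I. ?B)"
  proof (rule sum_mono, clarify)
    fix w g assume w: "w \<in> labels n K'" and g: "g \<in> grid n K'"
    have eta: "curry g \<in> Theta K'" using g by (simp add: grid_def)
    have q: "0 \<le> curry g (w i) (w j) \<and> curry g (w i) (w j) \<le> 1" if "(i, j) \<in> pairs n" for i j
      using label_pair[OF w that] eta unfolding Theta_def by blast
    have "measure ?M (E (w, g)) \<le> exp (t / 2 - sq_dist n \<theta> z (curry g) w / 4)"
      unfolding E_def prod.case using p01 q by (rule prob_lik_gt_le)
    also have "\<dots> \<le> ?B"
    proof -
      have "- sq_dist n \<theta> z (curry g) w / c\<^sup>2 \<le> (real n)\<^sup>2 * mu n K K' \<theta> z"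
        by (rule mu_ge_sq_dist[OF c n th bd eta w K'])
      then have "- sq_dist n \<theta> z (curry g) w \<le> c\<^sup>2 * (real n)\<^sup>2 * mu n K K' \<theta> z"
        using c by (subst (asm) pos_divide_le_eq) (simp_all add: mult_ac)
      then show ?thesis by simp
    qed
    finally show "measure ?M (E (w, g)) \<le> ?B" .
  qed
  also have "\<dots> = real K' ^ n * real (card (grid n K')) * ?B"
    by (simp add: card_cartesian_product labels_def card_PiE)
  also have "\<dots> \<le> real K' ^ n * real (n\<^sup>2 + 1) ^ (2 * K'\<^sup>2) * ?B"
  proof (intro mult_right_mono mult_left_mono)
    show "real (card (grid n K')) \<le> real (n\<^sup>2 + 1) ^ (2 * K'\<^sup>2)"
      using card_grid_le[of n K'] by (metis of_nat_le_iff of_nat_power)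
  qed auto
  finally show ?thesis .
qed

section \<open>The penalised comparisons and the theorem\<close>

text \<open>Here \<open>t\<close> is the penalty of the true order. Dropping the nonnegative penalty
  of \<open>K'\<close> and bounding the maximum for \<open>K\<close> below by the true parameter,
  the event forces the likelihood ratio above \<open>- t\<close>.\<close>

lemma prob_cbic_underfit_le:
  assumes c: "0 < c" "c \<le> 1 / 2" and n: "1 \<le> n"
    and th: "\<theta> \<in> Theta K" "z \<in> labels n K"
    and bd: "\<And>a b. a \<in> {1..K} \<Longrightarrow> b \<in> {1..K} \<Longrightarrow> c \<le> \<theta> a b \<and> \<theta> a b \<le> 1 - c"
    and K': "1 \<le> K'" and lam: "0 \<le> lam"
    and t: "t = lam * real n * ln (real K) + real K * (real K + 1) / 2 * ln (real n)"
  shows "measure_pmf.prob (sbm n \<theta> z) {A. cbic n lam K' A > cbic n lam K A}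
    \<le> real K' ^ n * real (n\<^sup>2 + 1) ^ (2 * K'\<^sup>2) * exp (t / 2 + c\<^sup>2 * (real n)\<^sup>2 * mu n K K' \<theta> z / 4)"
proof -
  let ?M = "measure_pmf (sbm n \<theta> z)"
  have p01: "0 < \<theta> (z i) (z j) \<and> \<theta> (z i) (z j) < 1" if "(i, j) \<in> pairs n" for i j
    using bd[OF label_pair[OF th(2) that]] c by auto
  have "measure ?M {A. cbic n lam K' A > cbic n lam K A} \<le> measure ?M {A. LR n K K' \<theta> z A > ereal (- t)}"
  proof (rule measure_pmf.finite_measure_mono_AE)
    show "AE A in ?M. A \<in> {A. cbic n lam K' A > cbic n lam K A} \<longrightarrow> A \<in> {A. LR n K K' \<theta> z A > ereal (- t)}"
    proof (rule AE_pmfI, rule impI)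
      fix A assume A: "A \<in> set_pmf (sbm n \<theta> z)" "A \<in> {A. cbic n lam K' A > cbic n lam K A}"
      note sym = sbm_sym[OF A(1)]
      have y: "0 < lik n A \<theta> z" using p01 by (rule lik_pos)
      have minus_less: "ereal (- s) < m - ereal r" if "ereal r - ereal s < m" for m :: ereal and r s
        using that by (cases m) auto
      have ll: "loglik n K A \<theta> z = ereal (ln (lik n A \<theta> z))"
        using y by (simp add: loglik_eq_elog_lik[of A, OF sym th] elog_def)
      have "0 \<le> lam * real n * ln (real K') + real K' * (real K' + 1) / 2 * ln (real n)"
        using lam n K' by (intro add_nonneg_nonneg mult_nonneg_nonneg) auto
      then have "cbic n lam K' A \<le> max_loglik n K' A"
        unfolding cbic_def by (cases "max_loglik n K' A") auto
      moreover have "loglik n K A \<theta> z - ereal t \<le> cbic n lam K A"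
        unfolding cbic_def t by (intro ereal_minus_mono loglik_le_max_loglik th order_refl)
      moreover have "cbic n lam K A < cbic n lam K' A" using A(2) by simp
      ultimately have "loglik n K A \<theta> z - ereal t < max_loglik n K' A"
        by (meson order_le_less_trans order_less_le_trans)
      then show "A \<in> {A. LR n K K' \<theta> z A > ereal (- t)}"
        unfolding LR_def ll mem_Collect_eq by (rule minus_less)
    qed
  qed simp
  also note prob_LR_gt_le[OF c n th bd K']
  finally show ?thesis .
qed

text \<open>Whenever the overfitting bound holds, the likelihood gains at most
  \<open>\<alpha> * n * ln K'\<close>. The condition on \<open>lam\<close> makes the first penalty
  term grow by at least this much, and the second term increases with the number of
  communities.\<close>

lemma prob_cbic_overfit_le:
  assumes n: "1 \<le> n"
    and th: "\<theta> \<in> Theta K" "z \<in> labels n K"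
    and p01: "\<And>a b. a \<in> {1..K} \<Longrightarrow> b \<in> {1..K} \<Longrightarrow> 0 < \<theta> a b \<and> \<theta> a b < 1"
    and K: "1 \<le> K" "K < K'"
    and lam: "lam > \<alpha> * ln (real K') / (ln (real K') - ln (real K))"
  shows "measure_pmf.prob (sbm n \<theta> z) {A. cbic n lam K' A > cbic n lam K A}
    \<le> 1 - measure_pmf.prob (sbm n \<theta> z)
        {A. LR n K K' \<theta> z A \<le> ereal (\<alpha> * real n * ln (real K')) + (sup_loglik n K A z - loglik n K A \<theta> z)}"
proof -
  let ?M = "measure_pmf (sbm n \<theta> z)"
  let ?S = "{A. LR n K K' \<theta> z A \<le> ereal (\<alpha> * real n * ln (real K')) + (sup_loglik n K A z - loglik n K A \<theta> z)}"
  have "measure ?M {A. cbic n lam K' A > cbic n lam K A} \<le> measure ?M (UNIV - ?S)"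
  proof (rule measure_pmf.finite_measure_mono_AE)
    show "AE A in ?M. A \<in> {A. cbic n lam K' A > cbic n lam K A} \<longrightarrow> A \<in> UNIV - ?S"
    proof (rule AE_pmfI, rule impI, rule DiffI, simp, rule notI)
      fix A assume A: "A \<in> set_pmf (sbm n \<theta> z)" "A \<in> {A. cbic n lam K' A > cbic n lam K A}" "A \<in> ?S"
      note sym = sbm_sym[OF A(1)]
      have y: "0 < lik n A \<theta> z" using p01 label_pair[OF th(2)] by (intro lik_pos) blast
      have ll: "loglik n K A \<theta> z = ereal (ln (lik n A \<theta> z))"
        using y by (simp add: loglik_eq_elog_lik[of A, OF sym th] elog_def)
      \<comment> \<open>The log-likelihood of the truth is finite, so it cancels from both sides;
        the supremum at the true labels is below the maximum over all labels.\<close>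
      have 1: "max_loglik n K' A \<le> ereal (\<alpha> * real n * ln (real K')) + max_loglik n K A"
        using A(3) sup_loglik_le_max_loglik[OF th(2), of A] unfolding LR_def ll mem_Collect_eq
        by (cases "max_loglik n K' A"; cases "max_loglik n K A"; cases "sup_loglik n K A z") auto
      have dln: "0 < ln (real K') - ln (real K)" using K by simp
      have "\<alpha> * ln (real K') < lam * (ln (real K') - ln (real K))"
        using lam dln by (simp add: pos_divide_less_eq)
      then have "\<alpha> * ln (real K') * real n \<le> lam * (ln (real K') - ln (real K)) * real n"
        by (intro mult_right_mono) auto
      then have "\<alpha> * real n * ln (real K') + lam * real n * ln (real K) \<le> lam * real n * ln (real K')"
        by (simp add: algebra_simps)
      moreover have "real K * (real K + 1) / 2 * ln (real n) \<le> real K' * (real K' + 1) / 2 * ln (real n)"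
        using K n by (intro mult_right_mono divide_right_mono mult_mono) auto
      ultimately have 2: "\<alpha> * real n * ln (real K') + (lam * real n * ln (real K) + real K * (real K + 1) / 2 * ln (real n))
          \<le> lam * real n * ln (real K') + real K' * (real K' + 1) / 2 * ln (real n)" by linarith
      have "cbic n lam K' A \<le> cbic n lam K A"
        using 1 2 unfolding cbic_def
        by (cases "max_loglik n K' A"; cases "max_loglik n K A") auto
      then show False using A(2) by auto
    qed
  qed simp
  also have "\<dots> = 1 - measure ?M ?S"
    by (subst measure_pmf.prob_compl[symmetric]) auto
  finally show ?thesis .
qed

text \<open>The constant is a budget in units of \<open>n * ln k\<close>: 1 pays for the labels,
  \<open>lam / 2\<close> for half the linear penalty, and \<open>7 / ln 2\<close> for the
  \<open>6 * n\<close> of the grid plus the \<open>n\<close> of the quadratic penalty. One unit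
  remains, and it is at least \<open>n * ln 2\<close>.\<close>

lemma underfit_bound_le:
  fixes k k' n :: nat and lam c m :: real
  assumes k: "1 \<le> k'" "k' < k" and n: "2 \<le> n" and growth: "(real k)\<^sup>2 * ln (real n) \<le> real n"
    and small: "c\<^sup>2 / 4 * (real n * m / ln (real k)) \<le> - (2 + 7 / ln 2 + lam / 2)"
    and lam: "0 \<le> lam"
  shows "real k' ^ n * real (n\<^sup>2 + 1) ^ (2 * k'\<^sup>2)
      * exp ((lam * real n * ln (real k) + real k * (real k + 1) / 2 * ln (real n)) / 2 + c\<^sup>2 * (real n)\<^sup>2 * m / 4)
    \<le> (1 / 2) ^ n"
proof -
  define L where "L = ln (real k)"
  have L2: "ln 2 \<le> L" using k by (simp add: L_def)
  have l2: "0 < ln (2::real)" by simp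
  have L: "0 < L" using L2 l2 by linarith
  have lnn: "0 \<le> ln (real n)" using n by simp
  \<comment> \<open>As \<open>k \<ge> 2\<close>, a cost linear in \<open>n\<close> can be charged to
    \<open>n * ln k\<close> at the rate \<open>1 / ln 2\<close>.\<close>
  have nn: "real n \<le> real n * L / ln 2"
    using L2 l2 n by (simp add: pos_le_divide_eq mult_left_mono)
  have 1: "real n * ln (real k') \<le> real n * L"
    using k unfolding L_def by (intro mult_left_mono) auto
  have 2: "real (2 * k'\<^sup>2) * ln (real (n\<^sup>2 + 1)) \<le> 6 * real n"
  proof -
    \<comment> \<open>The cube replaces the logarithm of the grid base by \<open>3 * ln n\<close>;
      with the exponent \<open>2 * k'\<^sup>2\<close> this yields the factor 6.\<close>
    have "n\<^sup>2 + 1 \<le> n ^ 3"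
    proof -
      have "1 \<le> n\<^sup>2" using n by simp
      then have "n\<^sup>2 + 1 \<le> 2 * n\<^sup>2" by linarith
      also have "\<dots> \<le> n * n\<^sup>2" using n by (intro mult_right_mono) auto
      finally show ?thesis by (simp add: power3_eq_cube power2_eq_square)
    qed
    then have "real (n\<^sup>2 + 1) \<le> real n ^ 3" by (metis of_nat_le_iff of_nat_power)
    then have "ln (real (n\<^sup>2 + 1)) \<le> ln (real n ^ 3)"
      using n by (intro ln_mono) (auto intro: add_pos_nonneg)
    then have "ln (real (n\<^sup>2 + 1)) \<le> 3 * ln (real n)"
      using n by (simp add: ln_realpow)
    then have "real (2 * k'\<^sup>2) * ln (real (n\<^sup>2 + 1)) \<le> real (2 * k\<^sup>2) * (3 * ln (real n))"
      using k lnn by (intro mult_mono) (auto intro!: power_mono)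
    also have "\<dots> = 6 * ((real k)\<^sup>2 * ln (real n))" by simp
    finally show ?thesis using growth by linarith
  qed
  have 3: "real k * (real k + 1) / 2 * ln (real n) / 2 \<le> real n"
  proof -
    have "real k * (real k + 1) \<le> real k * (4 * real k)"
      using k by (intro mult_left_mono) auto
    then have "real k * (real k + 1) \<le> 4 * (real k)\<^sup>2"
      by (simp add: power2_eq_square)
    then have "real k * (real k + 1) * ln (real n) \<le> 4 * (real k)\<^sup>2 * ln (real n)"
      using lnn by (rule mult_right_mono)
    with growth show ?thesis by simp
  qed
  have 4: "c\<^sup>2 * (real n)\<^sup>2 * m / 4 \<le> - (2 + 7 / ln 2 + lam / 2) * (real n * L)"
  proof -
    have "c\<^sup>2 * (real n)\<^sup>2 * m / 4 = c\<^sup>2 / 4 * (real n * m / L) * (real n * L)"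
      using L by (simp add: power2_eq_square)
    also have "\<dots> \<le> - (2 + 7 / ln 2 + lam / 2) * (real n * L)"
      using small L unfolding L_def by (intro mult_right_mono) auto
    finally show ?thesis .
  qed
  let ?G = "real n * ln (real k') + real (2 * k'\<^sup>2) * ln (real (n\<^sup>2 + 1)) +
    ((lam * real n * L + real k * (real k + 1) / 2 * ln (real n)) / 2 + c\<^sup>2 * (real n)\<^sup>2 * m / 4)"
  have "?G \<le> real n * L + 6 * real n + (lam * real n * L / 2 + real n) - (2 + 7 / ln 2 + lam / 2) * (real n * L)"
    using 1 2 3 4 unfolding add_divide_distrib minus_mult_left[symmetric] by linarith
  also have "\<dots> = - (real n * L) + 7 * (real n - real n * L / ln 2)"
    by (simp add: algebra_simps)
  also have "\<dots> \<le> - (real n * ln 2)"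
  proof -
    have "real n * ln 2 \<le> real n * L" using L2 by (rule mult_left_mono) simp
    moreover have "7 * (real n - real n * L / ln 2) \<le> 0" using nn by simp
    ultimately show ?thesis by simp
  qed
  finally have G: "?G \<le> - (real n * ln 2)" .
  have pw: "x ^ j = exp (real j * ln x)" if "0 < x" for x :: real and j
    using that by (simp add: exp_of_nat_mult)
  have pos: "0 < real k'" "0 < real (n\<^sup>2 + 1)" using k by (auto intro: add_pos_nonneg)
  have "real k' ^ n * real (n\<^sup>2 + 1) ^ (2 * k'\<^sup>2)
      * exp ((lam * real n * ln (real k) + real k * (real k + 1) / 2 * ln (real n)) / 2 + c\<^sup>2 * (real n)\<^sup>2 * m / 4)
    = exp ?G"
    unfolding pw[OF pos(1)] pw[OF pos(2)] L_def exp_add[symmetric] ..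
  also have "\<dots> \<le> exp (- (real n * ln 2))" using G by simp
  also have "\<dots> = (1 / 2) ^ n"
    by (simp add: exp_minus exp_of_nat_mult power_one_over inverse_eq_divide)
  finally show ?thesis .
qed

theorem theorem4:
  fixes k :: "nat \<Rightarrow> nat"
    and \<theta> :: "nat \<Rightarrow> nat \<Rightarrow> nat \<Rightarrow> real"
    and z :: "nat \<Rightarrow> nat \<Rightarrow> nat"
    and lam :: real
  assumes k_pos: "\<And>n. 1 \<le> k n"
    and theta: "\<And>n. \<theta> n \<in> Theta (k n)"
    and labels: "\<And>n. z n \<in> labels n (k n)"
    and A1: "\<exists>C1>0. \<forall>n. \<forall>a\<in>{1..k n}. real (comm_size n (z n) a) \<ge> C1 * real n / real (k n)"
    and A2: "\<forall>n. \<forall>a\<in>{1..k n}. \<forall>b\<in>{1..k n}. a \<noteq> b \<longrightarrow> (\<exists>c\<in>{1..k n}. \<theta> n a c \<noteq> \<theta> n b c)"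
    and A3: "\<exists>c>0. \<forall>n. \<forall>a\<in>{1..k n}. \<forall>b\<in>{1..k n}. c \<le> \<theta> n a b \<and> \<theta> n a b \<le> 1 - c"
    and A4: "\<forall>k'. (\<forall>\<^sub>F n in sequentially. 1 \<le> k' n \<and> k' n < k n) \<longrightarrow>
               filterlim (\<lambda>n. real n * mu n (k n) (k' n) (\<theta> n) (z n) / ln (real (k n)))
                 at_bot sequentially"
    and lambda: "lam \<ge> 0"
    and k_growth: "(\<lambda>n. real (k n)) \<in> o(\<lambda>n. sqrt (real n / ln (real n)))"
  shows "(\<forall>k'. (\<forall>\<^sub>F n in sequentially. 1 \<le> k' n \<and> k' n < k n) \<longrightarrow>
            (\<lambda>n. measure_pmf.prob (sbm n (\<theta> n) (z n))
                   {A. cbic n lam (k' n) A > cbic n lam (k n) A}) \<longlonglongrightarrow> 0) \<and>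
         (\<forall>k' \<alpha>. (\<forall>\<^sub>F n in sequentially. k n < k' n) \<longrightarrow>
            overfit_coeff k \<theta> z k' \<alpha> \<longrightarrow>
            (\<forall>\<^sub>F n in sequentially.
               lam > \<alpha> n * ln (real (k' n)) / (ln (real (k' n)) - ln (real (k n)))) \<longrightarrow>
            (\<lambda>n. measure_pmf.prob (sbm n (\<theta> n) (z n))
                   {A. cbic n lam (k' n) A > cbic n lam (k n) A}) \<longlonglongrightarrow> 0)"
proof -
  obtain c0 where c0: "0 < c0" "\<And>n a b. a \<in> {1..k n} \<Longrightarrow> b \<in> {1..k n} \<Longrightarrow> c0 \<le> \<theta> n a b \<and> \<theta> n a b \<le> 1 - c0"
    using A3 by blast
  \<comment> \<open>The cap at \<open>1 / 2\<close> keeps the interval \<open>[c, 1 - c]\<close>, to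
    which competitors are clamped, nonempty.\<close>
  define c where "c = min c0 (1 / 2)"
  have c: "0 < c" "c \<le> 1 / 2" using c0(1) by (auto simp: c_def)
  have bd: "c \<le> \<theta> n a b \<and> \<theta> n a b \<le> 1 - c" if "a \<in> {1..k n}" "b \<in> {1..k n}" for n a b
    using c0(2)[OF that] by (auto simp: c_def)
  have p01: "0 < \<theta> n a b \<and> \<theta> n a b < 1" if "a \<in> {1..k n}" "b \<in> {1..k n}" for n a b
    using bd[OF that] c by auto
  let ?P = "\<lambda>k' n. measure_pmf.prob (sbm n (\<theta> n) (z n)) {A. cbic n lam (k' n) A > cbic n lam (k n) A}"
  \<comment> \<open>The little-o hypothesis is taken with constant 1 and squared; from
    \<open>n = 2\<close> on the logarithm is positive and can be multiplied out.\<close>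
  have growth: "\<forall>\<^sub>F n in sequentially. (real (k n))\<^sup>2 * ln (real n) \<le> real n"
    using landau_o.smallD[OF k_growth zero_less_one] eventually_ge_at_top[of 2]
  proof eventually_elim
    case (elim n)
    have l: "0 < ln (real n)" using elim(2) by simp
    have "real (k n) \<le> sqrt (real n / ln (real n))" using elim l by simp
    then have "(real (k n))\<^sup>2 \<le> (sqrt (real n / ln (real n)))\<^sup>2" by (intro power_mono) auto
    also have "\<dots> = real n / ln (real n)" using l by simp
    finally show ?case using l by (simp add: pos_le_divide_eq)
  qed
  have "?P k' \<longlonglongrightarrow> 0" if k': "\<forall>\<^sub>F n in sequentially. 1 \<le> k' n \<and> k' n < k n" for k'
  proof (rule tendsto_sandwich[where f = "\<lambda>_. 0" and h = "\<lambda>n. (1 / 2) ^ n"])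
    have "filterlim (\<lambda>n. real n * mu n (k n) (k' n) (\<theta> n) (z n) / ln (real (k n))) at_bot sequentially"
      using A4 k' by blast
    \<comment> \<open>Divergence to minus infinity is invoked at a single level, the budget of
      \<open>underfit_bound_le\<close> divided by the factor \<open>c\<^sup>2 / 4\<close> from the
      union bound.\<close>
    then have "\<forall>\<^sub>F n in sequentially. real n * mu n (k n) (k' n) (\<theta> n) (z n) / ln (real (k n))
        \<le> - (2 + 7 / ln 2 + lam / 2) / (c\<^sup>2 / 4)"
      by (simp add: filterlim_at_bot)
    then show "\<forall>\<^sub>F n in sequentially. ?P k' n \<le> (1 / 2) ^ n"
      using k' growth eventually_ge_at_top[of 2]
    proof eventually_elim
      case (elim n)
      have "c\<^sup>2 / 4 * (real n * mu n (k n) (k' n) (\<theta> n) (z n) / ln (real (k n))) \<le> - (2 + 7 / ln 2 + lam / 2)"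
        using elim(1) c by (subst (asm) pos_le_divide_eq) (auto simp: mult_ac)
      note bound = underfit_bound_le[OF conjunct1[OF elim(2)] conjunct2[OF elim(2)] elim(4) elim(3) this lambda]
      have "1 \<le> n" using elim(4) by simp
      from prob_cbic_underfit_le[OF c this theta labels bd conjunct1[OF elim(2)] lambda refl] bound
      show ?case by (rule order_trans)
    qed
    show "(\<lambda>n. (1 / 2) ^ n :: real) \<longlonglongrightarrow> 0" by (rule LIMSEQ_realpow_zero) auto
  qed simp_all
  moreover have "?P k' \<longlonglongrightarrow> 0"
    if k': "\<forall>\<^sub>F n in sequentially. k n < k' n" and coeff: "overfit_coeff k \<theta> z k' \<alpha>"
      and lam: "\<forall>\<^sub>F n in sequentially. lam > \<alpha> n * ln (real (k' n)) / (ln (real (k' n)) - ln (real (k n)))"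
    for k' \<alpha>
  proof -
    let ?Q = "\<lambda>n. measure_pmf.prob (sbm n (\<theta> n) (z n))
        {A. LR n (k n) (k' n) (\<theta> n) (z n) A
              \<le> ereal (\<alpha> n * real n * ln (real (k' n)))
                + (sup_loglik n (k n) A (z n) - loglik n (k n) A (\<theta> n) (z n))}"
    \<comment> \<open>A wrong choice can only happen outside the overfitting event, whose
      probability tends to 1 by \<open>overfit_coeff\<close>.\<close>
    have le: "\<forall>\<^sub>F n in sequentially. ?P k' n \<le> 1 - ?Q n"
      using k' lam eventually_ge_at_top[of 1]
    proof eventually_elim
      case (elim n)
      show ?case
        by (rule prob_cbic_overfit_le[OF elim(3) theta labels p01 k_pos elim(1,2)])
    qed
    have "?Q \<longlonglongrightarrow> 1" using coeff by (simp add: overfit_coeff_def)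
    from tendsto_diff[OF tendsto_const this, of 1] have "(\<lambda>n. 1 - ?Q n) \<longlonglongrightarrow> 0" by simp
    then show ?thesis
      by (rule tendsto_sandwich[OF _ le tendsto_const, rotated]) simp
  qed
  ultimately show ?thesis by blast
qed

end
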